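(* Let $(X,d)$ and $(Y,\rho)$ be semimetric spaces with triangle functions $\Phi_1$ and $\Phi_2$, respectively, which are continuous and strictly increasing in both of their arguments, and let $f\colon X\to Y$ be an $\eta$-quasisymmetric mapping. Then $f$ maps bounded subspaces to bounded subspaces. Moreover, if $A\subseteq B\subseteq X$, $0<\operatorname{diam}A$ and $\operatorname{diam}B<\infty$, then $\operatorname{diam}f(B)$ is finite and $$\frac{\operatorname{diam}f(A)}{\operatorname{diam}f(B)}\leqslant\eta\left(\frac{\operatorname{diam}A}{\varphi_1^{-1}(\operatorname{diam}B)}\right),$$ $$\frac{1}{\eta\left(\frac{\operatorname{diam}B}{\operatorname{diam}A}\right)}\leqslant\frac{\operatorname{diam}f(A)}{\varphi_2^{-1}(\operatorname{diam}f(B))},$$ where $\varphi_1(t)=\Phi_1(t,t)$ and $\varphi_2(t)=\Phi_2(t,t)$.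
   Context: $\mathbb{R}^+=[0,\infty)$. A semimetric on a nonempty set $X$ is a function $d\colon X\times X\to\mathbb{R}^+$ with $d(x,y)=0\Leftrightarrow x=y$ and $d(x,y)=d(y,x)$; then $(X,d)$ is a semimetric space. A function $\Phi\colon\mathbb{R}^+\times\mathbb{R}^+\to\mathbb{R}^+$ is a triangle function for $(X,d)$ if it is symmetric, monotone increasing in both of its arguments, satisfies $\Phi(0,0)=0$, and $d(x,y)\leqslant\Phi(d(x,z),d(y,z))$ for all $x,y,z\in X$. Let $\eta\colon[0,\infty)\to[0,\infty)$ be a homeomorphism. A mapping $f\colon X\to Y$ between semimetric spaces $(X,d)$, $(Y,\rho)$ is $\eta$-quasisymmetric if it is nonconstant and $d(x,a)\leqslant t\,d(x,b)$ implies $\rho(f(x),f(a))\leqslant\eta(t)\rho(f(x),f(b))$ for all $a,b,x\in X$ and all $t>0$. For a nonempty subset $A$ of a semimetric space, $\operatorname{diam}A=\sup\{d(x,y):x,y\in A\}$, and $A$ is bounded if $\operatorname{diam}A<\infty$. Here $\varphi_i^{-1}$ is the inverse of the strictly increasing function $\varphi_i\colon[0,\infty)\to[0,\infty)$, defined on its range. *)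

theory Defs
  imports "HOL-Analysis.Analysis"
begin

text \<open>
  Spaces are given by a carrier set and a distance whose values off the carrier are irrelevant.
  Functions on \<open>[0,\<infinity>)\<close> are total functions on \<^typ>\<open>real\<close>, used only on \<^term>\<open>{0::real..}\<close>.
\<close>

locale semimetric_space =
  fixes X :: "'a set" and d :: "'a \<Rightarrow> 'a \<Rightarrow> real"
  assumes carrier_nonempty: "X \<noteq> {}"
    and dist_nonneg: "\<lbrakk>x \<in> X; y \<in> X\<rbrakk> \<Longrightarrow> 0 \<le> d x y"
    and dist_zero_iff: "\<lbrakk>x \<in> X; y \<in> X\<rbrakk> \<Longrightarrow> d x y = 0 \<longleftrightarrow> x = y"
    and dist_commute: "\<lbrakk>x \<in> X; y \<in> X\<rbrakk> \<Longrightarrow> d x y = d y x"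

definition triangle_function ::
    "'a set \<Rightarrow> ('a \<Rightarrow> 'a \<Rightarrow> real) \<Rightarrow> (real \<Rightarrow> real \<Rightarrow> real) \<Rightarrow> bool" where
  "triangle_function X d \<Phi> \<longleftrightarrow>
     (\<forall>s\<ge>0. \<forall>t\<ge>0. 0 \<le> \<Phi> s t) \<and>
     (\<forall>s\<ge>0. \<forall>t\<ge>0. \<Phi> s t = \<Phi> t s) \<and>
     (\<forall>t\<ge>0. mono_on {0..} (\<lambda>s. \<Phi> s t)) \<and>
     (\<forall>s\<ge>0. mono_on {0..} (\<lambda>t. \<Phi> s t)) \<and>
     \<Phi> 0 0 = 0 \<and>
     (\<forall>x\<in>X. \<forall>y\<in>X. \<forall>z\<in>X. d x y \<le> \<Phi> (d x z) (d y z))"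

definition continuous_strictly_increasing :: "(real \<Rightarrow> real \<Rightarrow> real) \<Rightarrow> bool" where
  "continuous_strictly_increasing \<Phi> \<longleftrightarrow>
     continuous_on ({0..} \<times> {0..}) (\<lambda>(s, t). \<Phi> s t) \<and>
     (\<forall>t\<ge>0. strict_mono_on {0..} (\<lambda>s. \<Phi> s t)) \<and>
     (\<forall>s\<ge>0. strict_mono_on {0..} (\<lambda>t. \<Phi> s t))"

definition quasisymmetric ::
    "(real \<Rightarrow> real) \<Rightarrow> 'a set \<Rightarrow> ('a \<Rightarrow> 'a \<Rightarrow> real) \<Rightarrow> 'b set \<Rightarrow> ('b \<Rightarrow> 'b \<Rightarrow> real)
      \<Rightarrow> ('a \<Rightarrow> 'b) \<Rightarrow> bool" where
  "quasisymmetric \<eta> X d Y \<rho> f \<longleftrightarrow>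
     (\<exists>\<eta>'. homeomorphism {0..} {0..} \<eta> \<eta>') \<and>
     f \<in> X \<rightarrow> Y \<and> \<not> f constant_on X \<and>
     (\<forall>a\<in>X. \<forall>b\<in>X. \<forall>x\<in>X. \<forall>t>0.
        d x a \<le> t * d x b \<longrightarrow> \<rho> (f x) (f a) \<le> \<eta> t * \<rho> (f x) (f b))"

text \<open>
  The diameter is extended-real valued, so that it can be infinite. On the empty set, where the
  diameter is not defined mathematically, it is \<open>-\<infinity>\<close>; hence \<open>0 < sdiam d A\<close> forces \<open>A \<noteq> {}\<close>.
\<close>

definition sdiam :: "('a \<Rightarrow> 'a \<Rightarrow> real) \<Rightarrow> 'a set \<Rightarrow> ereal" where
  "sdiam d A = (SUP (x, y)\<in>A \<times> A. ereal (d x y))"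

definition sbounded :: "('a \<Rightarrow> 'a \<Rightarrow> real) \<Rightarrow> 'a set \<Rightarrow> bool" where
  "sbounded d A \<longleftrightarrow> A \<noteq> {} \<and> sdiam d A < \<infinity>"

text \<open>
  The real-valued diameter, meaningful only if \<^const>\<open>sdiam\<close> is finite
  (\<^const>\<open>real_of_ereal\<close> sends \<open>\<infinity>\<close> to 0).
\<close>

definition rdiam :: "('a \<Rightarrow> 'a \<Rightarrow> real) \<Rightarrow> 'a set \<Rightarrow> real" where
  "rdiam d A = real_of_ereal (sdiam d A)"

end

theory Submission
  imports Defs
begin

text \<open>
  Write \<open>r = \<phi>\<inverse>(diam B)\<close>. If all points of \<open>B\<close> were within distance \<open>s < r\<close> of some point \<open>x\<close>,
  the triangle function would give \<open>diam B \<le> \<phi>(s) < \<phi>(r) = diam B\<close>. So from every \<open>x\<close> there are points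
  of \<open>B\<close> at distance more than \<open>s\<close>, for every \<open>s < r\<close>. Comparing such a point with points of \<open>A\<close> by
  quasisymmetry, and passing to the limit with the continuity of \<open>\<eta>\<close>, gives both estimates:
  the first with the far point chosen in \<open>B\<close>, the second with its image chosen far in \<open>f(B)\<close>.
\<close>

section \<open>Diameters in a semimetric space\<close>

context semimetric_space
begin

lemma sdiam_nonneg:
  assumes "A \<subseteq> X" "A \<noteq> {}"
  shows "0 \<le> sdiam d A"
proof -
  obtain x where x: "x \<in> A" using assms by blast
  have "ereal (d x x) \<le> sdiam d A"
    unfolding sdiam_def by (rule SUP_upper2[of "(x, x)"]) (use x in auto)
  moreover have "d x x = 0" using dist_zero_iff x assms by blast
  ultimately show ?thesis by (simp add: zero_ereal_def)
qed

lemma ereal_rdiam: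
  assumes "A \<subseteq> X" "A \<noteq> {}" "sdiam d A < \<infinity>"
  shows "ereal (rdiam d A) = sdiam d A"
  unfolding rdiam_def
  by (rule ereal_real') (use sdiam_nonneg[OF assms(1,2)] assms(3) in auto)

lemma dist_le_rdiam:
  assumes "A \<subseteq> X" "sdiam d A < \<infinity>" "x \<in> A" "y \<in> A"
  shows "d x y \<le> rdiam d A"
proof -
  have "ereal (d x y) \<le> sdiam d A"
    unfolding sdiam_def by (rule SUP_upper2[of "(x, y)"]) (use assms in auto)
  also have "\<dots> = ereal (rdiam d A)" using ereal_rdiam[of A] assms by (metis empty_iff)
  finally show ?thesis by simp
qed

lemma less_rdiamE:
  assumes "A \<subseteq> X" "A \<noteq> {}" "sdiam d A < \<infinity>" "s < rdiam d A"
  obtains x y where "x \<in> A" "y \<in> A" "s < d x y"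
proof -
  have "ereal s < sdiam d A" using assms by (simp flip: ereal_rdiam)
  then show ?thesis unfolding sdiam_def less_SUP_iff using that by auto
qed

lemma sdiam_posE:
  assumes "A \<subseteq> X" "0 < sdiam d A"
  obtains x y where "x \<in> A" "y \<in> A" "x \<noteq> y"
proof -
  obtain x y where "x \<in> A" "y \<in> A" "0 < d x y"
    using assms(2) unfolding sdiam_def less_SUP_iff by auto
  moreover from this have "x \<noteq> y" using dist_zero_iff[of x y] assms(1) by auto
  ultimately show ?thesis using that by blast
qed

lemma dist_pos:
  assumes "x \<in> X" "y \<in> X" "x \<noteq> y"
  shows "0 < d x y"
  using dist_nonneg[OF assms(1,2)] dist_zero_iff[OF assms(1,2)] assms(3) by linarith

lemma sdiam_pos:
  assumes "A \<subseteq> X" "x \<in> A" "y \<in> A" "x \<noteq> y"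
  shows "0 < sdiam d A"
proof -
  have "ereal 0 < ereal (d x y)" using dist_pos assms by auto
  also have "\<dots> \<le> sdiam d A"
    unfolding sdiam_def by (rule SUP_upper2[of "(x, y)"]) (use assms in auto)
  finally show ?thesis by (simp add: zero_ereal_def)
qed

lemma sdiam_mono:
  assumes "A \<subseteq> B"
  shows "sdiam d A \<le> sdiam d B"
  unfolding sdiam_def by (rule SUP_subset_mono) (use assms in auto)

text \<open>Monotonicity is applied in one argument at a time. The triangle inequality enters below
  only in this form: a set within distance \<open>s\<close> of one point has diameter at most
  \<open>\<Phi> s s\<close>.\<close>

lemma triangle_function_le_diagonal:
  assumes "triangle_function X d \<Phi>" "x \<in> X" "y \<in> X" "z \<in> X" "d x z \<le> s" "d y z \<le> s"
  shows "d x y \<le> \<Phi> s s"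
proof -
  have nonneg: "0 \<le> d x z" "0 \<le> d y z" using assms dist_nonneg by auto
  have "d x y \<le> \<Phi> (d x z) (d y z)" using assms unfolding triangle_function_def by blast
  also have "\<dots> \<le> \<Phi> s (d y z)"
    using assms nonneg unfolding triangle_function_def mono_on_def by auto
  also have "\<dots> \<le> \<Phi> s s"
    using assms nonneg unfolding triangle_function_def mono_on_def by auto
  finally show ?thesis .
qed

text \<open>Boundedness can thus be tested from a single centre, which is how image sets are handled
  later.\<close>

lemma sdiam_finite_of_near:
  assumes "triangle_function X d \<Phi>" "A \<subseteq> X" "z \<in> X" "\<And>x. x \<in> A \<Longrightarrow> d x z \<le> K"
  shows "sdiam d A < \<infinity>"
proof -
  have "d x y \<le> \<Phi> K K" if "x \<in> A" "y \<in> A" for x y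
    using triangle_function_le_diagonal[OF assms(1)] that assms(2-4) by blast
  then have "sdiam d A \<le> ereal (\<Phi> K K)" unfolding sdiam_def by (auto intro: SUP_least)
  then show ?thesis by (auto simp: less_ereal.simps intro: le_less_trans)
qed

end

section \<open>The diagonal of a triangle function and its inverse at diameters\<close>

lemma strict_mono_on_diagonal:
  assumes "continuous_strictly_increasing \<Phi>"
  shows "strict_mono_on {0..} (\<lambda>t. \<Phi> t t)"
proof (rule strict_mono_onI)
  fix s t :: real assume st: "s \<in> {0..}" "t \<in> {0..}" "s < t"
  then have "\<Phi> s s < \<Phi> t s" "\<Phi> t s < \<Phi> t t"
    using assms unfolding continuous_strictly_increasing_def strict_mono_on_def by auto
  then show "\<Phi> s s < \<Phi> t t" by simp
qed

lemma continuous_on_diagonal: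
  assumes "continuous_strictly_increasing \<Phi>"
  shows "continuous_on {0..} (\<lambda>t. \<Phi> t t)"
proof -
  have "continuous_on {0..} ((\<lambda>(s, t). \<Phi> s t) \<circ> (\<lambda>t. (t, t)))"
    using assms unfolding continuous_strictly_increasing_def
    by (intro continuous_on_compose continuous_intros) (auto elim: continuous_on_subset)
  then show ?thesis by (simp add: o_def)
qed

locale regular_semimetric_space = semimetric_space +
  fixes \<Phi> :: "real \<Rightarrow> real \<Rightarrow> real" and \<phi> :: "real \<Rightarrow> real"
  assumes triangle: "triangle_function X d \<Phi>"
    and regular: "continuous_strictly_increasing \<Phi>"
    and diagonal: "\<phi> = (\<lambda>t. \<Phi> t t)"
begin

lemma strict_mono_diagonal: "strict_mono_on {0..} \<phi>"
  using strict_mono_on_diagonal[OF regular] diagonal by simp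

lemma diagonal_zero: "\<phi> 0 = 0"
  using triangle diagonal unfolding triangle_function_def by simp

lemma rdiam_pos:
  assumes "A \<subseteq> X" "0 < sdiam d A" "sdiam d A < \<infinity>"
  shows "0 < rdiam d A"
proof -
  have "A \<noteq> {}" using sdiam_posE[OF assms(1,2)] by blast
  then have "ereal (rdiam d A) = sdiam d A" using ereal_rdiam assms by blast
  then show ?thesis using assms(2) by (metis ereal_less(2))
qed

text \<open>The diagonal may be bounded, so this is not automatic. A set lies within its diameter
  \<open>D\<close> of each of its points, hence \<open>D \<le> \<phi> D\<close>, and the
  intermediate value theorem on \<open>{0..D}\<close> gives a preimage.\<close>

lemma rdiam_in_diagonal_range:
  assumes "A \<subseteq> X" "A \<noteq> {}" "sdiam d A < \<infinity>"
  shows "rdiam d A \<in> \<phi> ` {0..}"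
proof -
  let ?D = "rdiam d A"
  have "ereal 0 \<le> ereal ?D"
    using sdiam_nonneg[OF assms(1,2)] ereal_rdiam[OF assms] by (simp add: zero_ereal_def)
  then have D0: "0 \<le> ?D" by simp
  have "?D \<le> \<phi> ?D"
  proof (rule ccontr)
    assume "\<not> ?D \<le> \<phi> ?D"
    then obtain x y where xy: "x \<in> A" "y \<in> A" "\<phi> ?D < d x y"
      using less_rdiamE[OF assms, of "\<phi> ?D"] by auto
    \<comment> \<open>The point \<open>x\<close> itself serves as the centre.\<close>
    moreover have "d x x \<le> ?D" "d y x \<le> ?D" using dist_le_rdiam assms xy by blast+
    ultimately show False
      using triangle_function_le_diagonal[OF triangle, of x y x ?D] assms diagonal by auto
  qed
  moreover have "continuous_on {0..?D} \<phi>"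
    using continuous_on_diagonal[OF regular] diagonal by (auto elim: continuous_on_subset)
  ultimately obtain r where "0 \<le> r" "\<phi> r = ?D"
    using IVT'[of \<phi> 0 ?D ?D] D0 diagonal_zero by auto
  then show ?thesis by force
qed

lemma diagonal_the_inv_into_rdiam:
  assumes "A \<subseteq> X" "A \<noteq> {}" "sdiam d A < \<infinity>"
  shows "\<phi> (the_inv_into {0..} \<phi> (rdiam d A)) = rdiam d A"
  using f_the_inv_into_f[OF strict_mono_on_imp_inj_on[OF strict_mono_diagonal]]
    rdiam_in_diagonal_range[OF assms] by blast

lemma the_inv_into_rdiam_pos:
  assumes "A \<subseteq> X" "0 < sdiam d A" "sdiam d A < \<infinity>"
  shows "0 < the_inv_into {0..} \<phi> (rdiam d A)"
proof -
  let ?r = "the_inv_into {0..} \<phi> (rdiam d A)"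
  have ne: "A \<noteq> {}" using sdiam_posE[OF assms(1,2)] by blast
  have "?r \<in> {0..}"
    using the_inv_into_into[OF strict_mono_on_imp_inj_on[OF strict_mono_diagonal]
        rdiam_in_diagonal_range[OF assms(1) ne assms(3)] order_refl] .
  moreover have "?r \<noteq> 0"
    using diagonal_the_inv_into_rdiam[OF assms(1) ne assms(3)] diagonal_zero rdiam_pos[OF assms]
    by force
  ultimately show ?thesis by simp
qed

lemma far_pointE:
  assumes "A \<subseteq> X" "A \<noteq> {}" "sdiam d A < \<infinity>" "x \<in> X"
    and s: "0 \<le> s" "s < the_inv_into {0..} \<phi> (rdiam d A)"
  obtains b where "b \<in> A" "s < d x b"
proof (rule ccontr)
  assume "\<not> thesis"
  with that have "\<And>b. b \<in> A \<Longrightarrow> d x b \<le> s" by force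
  then have near: "\<And>b. b \<in> A \<Longrightarrow> d b x \<le> s" using dist_commute assms(1,4) by (metis subsetD)
  \<comment> \<open>Strictness leaves room for a pair of points beyond \<open>\<phi> s\<close>,
    although the diameter need not be attained.\<close>
  have "\<phi> s < rdiam d A"
    using strict_mono_onD[OF strict_mono_diagonal _ _ s(2)] s diagonal_the_inv_into_rdiam[OF assms(1-3)]
    by auto
  then obtain y z where "y \<in> A" "z \<in> A" "\<phi> s < d y z" using less_rdiamE[OF assms(1-3)] by blast
  moreover from this have "d y z \<le> \<phi> s"
    using triangle_function_le_diagonal[OF triangle, of y z x s] near assms diagonal by auto
  ultimately show False by simp
qed

end

text \<open>Far points exist only at distances strictly below the critical value \<open>r\<close>.
  Letting \<open>s\<close> increase to \<open>r\<close> turns the resulting bounds into the bound at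
  \<open>r\<close> itself.\<close>

lemma le_at_quotient_of_less:
  fixes \<eta> :: "real \<Rightarrow> real"
  assumes "continuous_on {0..} \<eta>" "0 < c" "0 < r"
    and le: "\<And>s. 0 < s \<Longrightarrow> s < r \<Longrightarrow> K \<le> \<eta> (c / s) * M"
  shows "K \<le> \<eta> (c / r) * M"
proof (rule tendsto_lowerbound)
  \<comment> \<open>Since \<open>c / r\<close> is positive, it is interior to the half-line, so
    continuity there is two-sided.\<close>
  have "isCont \<eta> (c / r)"
    by (rule continuous_on_interior[OF assms(1)]) (use assms in \<open>simp add: interior_real_atLeast\<close>)
  moreover have "((\<lambda>s. c / s) \<longlongrightarrow> c / r) (at_left r)"
    using assms by (intro tendsto_intros) auto
  ultimately show "((\<lambda>s. \<eta> (c / s) * M) \<longlongrightarrow> \<eta> (c / r) * M) (at_left r)"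
    by (intro tendsto_mult[OF isCont_tendsto_compose[where g = \<eta>] tendsto_const])
  show "\<forall>\<^sub>F s in at_left r. K \<le> \<eta> (c / s) * M"
    using le eventually_at_left_real[OF assms(3)] by (auto elim: eventually_mono)
\<comment> \<open>What remains is that \<open>at_left r\<close> is a nontrivial filter.\<close>
qed simp

section \<open>Quasisymmetric maps and their distortion of diameters\<close>

locale quasisymmetric_map =
  dom: regular_semimetric_space X d \<Phi>1 \<phi>1 + cod: regular_semimetric_space Y \<rho> \<Phi>2 \<phi>2
  for X :: "'a set" and d \<Phi>1 \<phi>1 and Y :: "'b set" and \<rho> \<Phi>2 \<phi>2 +
  fixes \<eta> :: "real \<Rightarrow> real" and f :: "'a \<Rightarrow> 'b"
  assumes quasisymmetric: "quasisymmetric \<eta> X d Y \<rho> f"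
begin

lemma image_in: "x \<in> X \<Longrightarrow> f x \<in> Y"
  using quasisymmetric unfolding quasisymmetric_def by auto

lemma continuous_gauge: "continuous_on {0..} \<eta>"
  using quasisymmetric unfolding quasisymmetric_def homeomorphism_def by auto

lemma gauge_nonneg: "0 \<le> t \<Longrightarrow> 0 \<le> \<eta> t"
  using quasisymmetric unfolding quasisymmetric_def homeomorphism_def by auto

lemma distortion:
  assumes "a \<in> X" "b \<in> X" "x \<in> X" "0 < t" "d x a \<le> t * d x b"
  shows "\<rho> (f x) (f a) \<le> \<eta> t * \<rho> (f x) (f b)"
  using quasisymmetric assms unfolding quasisymmetric_def by blast

text \<open>If distinct \<open>a\<close> and \<open>b\<close> had the same image, comparing any
  \<open>x\<close> with \<open>b\<close> from \<open>a\<close> would bound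
  \<open>\<rho> (f a) (f x)\<close> by a multiple of zero, making \<open>f\<close> constant.\<close>

lemma inj_on_domain: "inj_on f X"
proof (rule inj_onI, rule ccontr)
  fix a b assume ab: "a \<in> X" "b \<in> X" "f a = f b" "a \<noteq> b"
  have "f x = f a" if x: "x \<in> X" for x
  proof -
    have pos: "0 < d a b" "0 \<le> d a x" using dom.dist_pos dom.dist_nonneg ab x by auto
    \<comment> \<open>The summand 1 keeps the ratio positive when \<open>x = a\<close>, as
      quasisymmetry requires \<open>t > 0\<close>.\<close>
    then have "d a x \<le> ((d a x + 1) / d a b) * d a b" "0 < (d a x + 1) / d a b" by auto
    then have "\<rho> (f a) (f x) \<le> \<eta> ((d a x + 1) / d a b) * \<rho> (f a) (f b)"
      using distortion ab x by blast
    also have "\<rho> (f a) (f b) = 0" using cod.dist_zero_iff image_in ab by metis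
    finally show ?thesis
      using cod.dist_nonneg[of "f a" "f x"] cod.dist_zero_iff[of "f a" "f x"] image_in ab x by auto
  qed
  then have "f constant_on X" unfolding constant_on_def by blast
  then show False using quasisymmetric unfolding quasisymmetric_def by blast
qed

lemma sdiam_image_pos:
  assumes "A \<subseteq> X" "0 < sdiam d A"
  shows "0 < sdiam \<rho> (f ` A)"
proof -
  obtain x y where xy: "x \<in> A" "y \<in> A" "x \<noteq> y" using dom.sdiam_posE[OF assms] by blast
  then have "f x \<noteq> f y" using inj_onD[OF inj_on_domain] assms by blast
  moreover have "f ` A \<subseteq> Y" using image_in assms by auto
  ultimately show ?thesis using cod.sdiam_pos xy by blast
qed

text \<open>For a fixed pair \<open>a \<noteq> b\<close> in \<open>A\<close>, quasisymmetry puts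
  every image within a fixed multiple of \<open>\<rho> (f a) (f b)\<close> from \<open>f a\<close>.
  The triangle function of \<open>Y\<close> then bounds the diameter.\<close>

lemma sdiam_image_finite:
  assumes "A \<subseteq> X" "sdiam d A < \<infinity>"
  shows "sdiam \<rho> (f ` A) < \<infinity>"
proof (cases "\<exists>a\<in>A. \<exists>b\<in>A. a \<noteq> b")
  case True
  then obtain a b where ab: "a \<in> A" "b \<in> A" "a \<noteq> b" by blast
  let ?t = "rdiam d A / d a b"
  have pos: "0 < d a b" using dom.dist_pos ab assms by auto
  have "d a b \<le> rdiam d A" using dom.dist_le_rdiam ab assms by blast
  then have t: "0 < ?t" using pos by auto
  have "\<rho> (f x) (f a) \<le> \<eta> ?t * \<rho> (f a) (f b)" if x: "x \<in> A" for x
  proof -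
    have "d a x \<le> ?t * d a b" using dom.dist_le_rdiam[OF assms] ab x pos by simp
    then have "\<rho> (f a) (f x) \<le> \<eta> ?t * \<rho> (f a) (f b)" using distortion t ab x assms by blast
    moreover have "\<rho> (f a) (f x) = \<rho> (f x) (f a)"
      using cod.dist_commute image_in ab x assms by blast
    ultimately show ?thesis by simp
  qed
  then show ?thesis
    using cod.sdiam_finite_of_near[OF cod.triangle, of "f ` A" "f a"] image_in ab assms by blast
next
  \<comment> \<open>Here \<open>A\<close> has at most one point; the empty set has diameter minus
    infinity.\<close>
  case False
  show ?thesis
  proof (cases "A = {}")
    case True
    then show ?thesis by (simp add: sdiam_def bot_ereal_def)
  next
    case ne: False
    then obtain a where "A = {a}" using False by blast
    then show ?thesis by (simp add: sdiam_def)
  qed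
qed

lemma sbounded_image:
  assumes "A \<subseteq> X" "sbounded d A"
  shows "sbounded \<rho> (f ` A)"
  using sdiam_image_finite assms unfolding sbounded_def by simp

text \<open>If \<open>b\<close> in \<open>B\<close> is farther than \<open>s\<close> from
  \<open>x\<close>, then \<open>d x y\<close> is at most \<open>rdiam d A / s\<close> times
  \<open>d x b\<close> for all \<open>y\<close> in \<open>A\<close>, and quasisymmetry carries this
  comparison to the images.\<close>

lemma rdiam_image_ratio_le:
  assumes AB: "A \<subseteq> B" "B \<subseteq> X" and A: "0 < sdiam d A" and B: "sdiam d B < \<infinity>"
  shows "rdiam \<rho> (f ` A) / rdiam \<rho> (f ` B)
    \<le> \<eta> (rdiam d A / the_inv_into {0..} \<phi>1 (rdiam d B))"
proof -
  let ?r = "the_inv_into {0..} \<phi>1 (rdiam d B)" and ?M = "rdiam \<rho> (f ` B)"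
  have AX: "A \<subseteq> X" using AB by simp
  have ne: "A \<noteq> {}" "B \<noteq> {}" using dom.sdiam_posE[OF AX A] AB by blast+
  have fin: "sdiam d A < \<infinity>" using dom.sdiam_mono[OF AB(1)] B by (rule le_less_trans)
  have Bpos: "0 < sdiam d B" using dom.sdiam_mono[OF AB(1)] A by simp
  have fA: "f ` A \<subseteq> Y" "f ` A \<noteq> {}" "sdiam \<rho> (f ` A) < \<infinity>"
    using image_in AX ne sdiam_image_finite[OF AX fin] by auto
  have fB: "f ` B \<subseteq> Y" "sdiam \<rho> (f ` B) < \<infinity>"
    using image_in AB sdiam_image_finite B by auto
  have M: "0 < ?M" using cod.rdiam_pos[OF fB(1) sdiam_image_pos fB(2)] AB Bpos by simp
  have c: "0 < rdiam d A" using dom.rdiam_pos[OF AX A fin] .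
  have r: "0 < ?r" using dom.the_inv_into_rdiam_pos[OF AB(2) Bpos B] .
  have le: "\<rho> (f x) (f y) \<le> \<eta> (rdiam d A / s) * ?M"
    if xy: "x \<in> A" "y \<in> A" and s: "0 < s" "s < ?r" for x y s
  proof -
    obtain b where b: "b \<in> B" "s < d x b"
      using dom.far_pointE[of B x s] AB ne B xy s by auto
    let ?t = "rdiam d A / s"
    have t: "0 < ?t" using c s by simp
    have "d x y \<le> ?t * s" using dom.dist_le_rdiam[OF AX fin] xy s by simp
    also have "\<dots> \<le> ?t * d x b" using b t by (intro mult_left_mono) auto
    finally have "\<rho> (f x) (f y) \<le> \<eta> ?t * \<rho> (f x) (f b)" using distortion t xy b AB by blast
    \<comment> \<open>The point \<open>b\<close> varies with \<open>s\<close>; bounding by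
      \<open>?M\<close> removes this dependence, so that the limit in \<open>s\<close> can be
      taken.\<close>
    also have "\<dots> \<le> \<eta> ?t * ?M"
      using cod.dist_le_rdiam[OF fB] xy b AB gauge_nonneg t by (intro mult_left_mono) auto
    finally show ?thesis .
  qed
  \<comment> \<open>The limit is taken for a fixed pair of points, and only then the supremum over
    pairs.\<close>
  have "rdiam \<rho> (f ` A) \<le> \<eta> (rdiam d A / ?r) * ?M"
  proof (rule ccontr)
    assume "\<not> ?thesis"
    then have less: "\<eta> (rdiam d A / ?r) * ?M < rdiam \<rho> (f ` A)" by simp
    obtain u v where "u \<in> f ` A" "v \<in> f ` A" "\<eta> (rdiam d A / ?r) * ?M < \<rho> u v"
      by (rule cod.less_rdiamE[OF fA less])
    then obtain x y where xy: "x \<in> A" "y \<in> A" "\<eta> (rdiam d A / ?r) * ?M < \<rho> (f x) (f y)"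
      by blast
    moreover have "\<rho> (f x) (f y) \<le> \<eta> (rdiam d A / ?r) * ?M"
      using le_at_quotient_of_less[OF continuous_gauge c r] le xy by blast
    ultimately show False by simp
  qed
  then show ?thesis using M by (simp add: divide_simps)
qed

text \<open>Now the far point is chosen in the image: \<open>f b\<close> is farther than
  \<open>s\<close> from \<open>f x\<close>, while \<open>x\<close> and \<open>y\<close> in
  \<open>A\<close> are more than \<open>a\<close> apart. Comparing \<open>d x b\<close> with
  \<open>d x y\<close> bounds \<open>s\<close>.\<close>

lemma rdiam_image_ratio_ge:
  assumes AB: "A \<subseteq> B" "B \<subseteq> X" and A: "0 < sdiam d A" and B: "sdiam d B < \<infinity>"
  shows "1 / \<eta> (rdiam d B / rdiam d A)
    \<le> rdiam \<rho> (f ` A) / the_inv_into {0..} \<phi>2 (rdiam \<rho> (f ` B))"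
proof -
  let ?r = "the_inv_into {0..} \<phi>2 (rdiam \<rho> (f ` B))" and ?M = "rdiam \<rho> (f ` A)"
  have AX: "A \<subseteq> X" using AB by simp
  have ne: "A \<noteq> {}" "B \<noteq> {}" using dom.sdiam_posE[OF AX A] AB by blast+
  have fin: "sdiam d A < \<infinity>" using dom.sdiam_mono[OF AB(1)] B by (rule le_less_trans)
  have Bpos: "0 < sdiam d B" using dom.sdiam_mono[OF AB(1)] A by simp
  have fA: "f ` A \<subseteq> Y" "sdiam \<rho> (f ` A) < \<infinity>"
    using image_in AX sdiam_image_finite[OF AX fin] by auto
  have fB: "f ` B \<subseteq> Y" "f ` B \<noteq> {}" "sdiam \<rho> (f ` B) < \<infinity>"
    using image_in AB ne sdiam_image_finite B by auto
  have M: "0 < ?M" using cod.rdiam_pos[OF fA(1) sdiam_image_pos[OF AX A] fA(2)] .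
  have D: "0 < rdiam d B" using dom.rdiam_pos[OF AB(2) Bpos B] .
  have c: "0 < rdiam d A" using dom.rdiam_pos[OF AX A fin] .
  have r: "0 < ?r"
    using cod.the_inv_into_rdiam_pos[OF fB(1) sdiam_image_pos[OF AB(2) Bpos] fB(3)] .
  \<comment> \<open>The bound does not depend on \<open>s\<close>, so density suffices to reach
    \<open>?r\<close>; the passage from \<open>a\<close> to \<open>rdiam d A\<close> changes the
    argument of \<open>\<eta>\<close> and needs its continuity.\<close>
  have le: "?r \<le> \<eta> (rdiam d B / a) * ?M" if a: "0 < a" "a < rdiam d A" for a
  proof (rule dense_le_bounded[OF r])
    fix s assume s: "0 < s" "s < ?r"
    obtain x y where xy: "x \<in> A" "y \<in> A" "a < d x y"
      using dom.less_rdiamE[OF AX ne(1) fin a(2)] by blast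
    have "f x \<in> Y" using xy image_in AX by blast
    then obtain v where "v \<in> f ` B" "s < \<rho> (f x) v"
      using cod.far_pointE[OF fB _ less_imp_le[OF s(1)] s(2)] by blast
    then obtain b where b: "b \<in> B" "s < \<rho> (f x) (f b)" by blast
    let ?t = "rdiam d B / a"
    have t: "0 < ?t" using D a by simp
    have "d x b \<le> ?t * a" using dom.dist_le_rdiam[OF AB(2) B, of x b] xy b a AB by auto
    also have "\<dots> \<le> ?t * d x y" using xy t by (intro mult_left_mono) auto
    finally have "\<rho> (f x) (f b) \<le> \<eta> ?t * \<rho> (f x) (f y)" using distortion t xy b AB by blast
    also have "\<dots> \<le> \<eta> ?t * ?M"
      using cod.dist_le_rdiam[OF fA] xy gauge_nonneg t by (intro mult_left_mono) auto
    finally show "s \<le> \<eta> ?t * ?M" using b by simp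
  qed
  have main: "?r \<le> \<eta> (rdiam d B / rdiam d A) * ?M"
    using le_at_quotient_of_less[OF continuous_gauge D c] le by blast
  \<comment> \<open>Positivity of \<open>\<eta>\<close> at this argument, needed for the division,
    is read off from the inequality and \<open>0 < ?r\<close>.\<close>
  then have "0 < \<eta> (rdiam d B / rdiam d A) * ?M" using r by simp
  then have "0 < \<eta> (rdiam d B / rdiam d A)" using M by (simp add: zero_less_mult_iff)
  then show ?thesis using main r by (simp add: divide_simps mult.commute)
qed

end

text \<open>The positive diameter of the image of \<open>B\<close> and the two range memberships
  ensure that the quotients and \<open>the_inv_into\<close> have their intended meaning rather than
  default values.\<close>

theorem theorem4p3:
  fixes X :: "'a set" and d :: "'a \<Rightarrow> 'a \<Rightarrow> real"
    and Y :: "'b set" and \<rho> :: "'b \<Rightarrow> 'b \<Rightarrow> real"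
    and \<Phi>1 \<Phi>2 :: "real \<Rightarrow> real \<Rightarrow> real"
    and \<phi>1 \<phi>2 :: "real \<Rightarrow> real"
    and \<eta> :: "real \<Rightarrow> real" and f :: "'a \<Rightarrow> 'b"
  assumes "semimetric_space X d" and "semimetric_space Y \<rho>"
    and "triangle_function X d \<Phi>1" and "continuous_strictly_increasing \<Phi>1"
    and "triangle_function Y \<rho> \<Phi>2" and "continuous_strictly_increasing \<Phi>2"
    and "quasisymmetric \<eta> X d Y \<rho> f"
    and "\<phi>1 = (\<lambda>t. \<Phi>1 t t)" and "\<phi>2 = (\<lambda>t. \<Phi>2 t t)"
  shows "(\<forall>A. A \<subseteq> X \<and> sbounded d A \<longrightarrow> sbounded \<rho> (f ` A)) \<and>
    (\<forall>A B. A \<subseteq> B \<and> B \<subseteq> X \<and> 0 < sdiam d A \<and> sdiam d B < \<infinity> \<longrightarrow>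
       0 < sdiam \<rho> (f ` B) \<and> sdiam \<rho> (f ` B) < \<infinity> \<and>
       rdiam d B \<in> \<phi>1 ` {0..} \<and> rdiam \<rho> (f ` B) \<in> \<phi>2 ` {0..} \<and>
       rdiam \<rho> (f ` A) / rdiam \<rho> (f ` B)
         \<le> \<eta> (rdiam d A / the_inv_into {0..} \<phi>1 (rdiam d B)) \<and>
       1 / \<eta> (rdiam d B / rdiam d A)
         \<le> rdiam \<rho> (f ` A) / the_inv_into {0..} \<phi>2 (rdiam \<rho> (f ` B)))"
proof -
  interpret quasisymmetric_map X d \<Phi>1 \<phi>1 Y \<rho> \<Phi>2 \<phi>2 \<eta> f
    using assms
    by (simp add: quasisymmetric_map_def quasisymmetric_map_axioms_def
        regular_semimetric_space_def regular_semimetric_space_axioms_def)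
  show ?thesis
  proof (intro conjI allI impI; (elim conjE)?)
    show "sbounded \<rho> (f ` A)" if "A \<subseteq> X" "sbounded d A" for A
      using sbounded_image that .
  next
    fix A B assume AB: "A \<subseteq> B" "B \<subseteq> X" "0 < sdiam d A" "sdiam d B < \<infinity>"
    have Bpos: "0 < sdiam d B" using dom.sdiam_mono[OF AB(1)] AB(3) by simp
    have ne: "B \<noteq> {}" using dom.sdiam_posE[OF AB(2) Bpos] by blast
    show "0 < sdiam \<rho> (f ` B)" using sdiam_image_pos[OF AB(2) Bpos] .
    show fin: "sdiam \<rho> (f ` B) < \<infinity>" using sdiam_image_finite[OF AB(2,4)] .
    show "rdiam d B \<in> \<phi>1 ` {0..}" using dom.rdiam_in_diagonal_range[OF AB(2) ne AB(4)] .
    show "rdiam \<rho> (f ` B) \<in> \<phi>2 ` {0..}"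
      using cod.rdiam_in_diagonal_range[OF _ _ fin] image_in AB(2) ne by auto
    show "rdiam \<rho> (f ` A) / rdiam \<rho> (f ` B)
        \<le> \<eta> (rdiam d A / the_inv_into {0..} \<phi>1 (rdiam d B))"
      using rdiam_image_ratio_le[OF AB] .
    show "1 / \<eta> (rdiam d B / rdiam d A)
        \<le> rdiam \<rho> (f ` A) / the_inv_into {0..} \<phi>2 (rdiam \<rho> (f ` B))"
      using rdiam_image_ratio_ge[OF AB] .
  qed
qed

end
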